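(* For every $\varepsilon>0$ there exists $C>1$ such that the following holds for all sufficiently large $n$. Let $\Delta\ge Cn/\log n$ be an integer, and suppose that $k=\lceil (n-1)/\Delta\rceil-1\ge 2$. If $G$ is an $n$-vertex graph with minimum degree $\delta(G)\ge n-n^{1-(1+\varepsilon)/k}$, then $G$ contains every tree in $\mathcal{T}(n,\Delta)$.
   Context: Graphs are finite and simple; $\log$ is the natural logarithm. $\mathcal{T}(n,\Delta)$ denotes the set of all $n$-vertex trees with maximum degree at most $\Delta$. A graph $G$ contains a tree $T$ if $G$ has a (not necessarily induced) subgraph isomorphic to $T$. "For all sufficiently large $n$" means for all $n\ge n_0$, where $n_0$ depends only on $\varepsilon$ and $C$. *)

theory Defs
  imports Complex_Main "Graph_Theory.Graph_Theory"
begin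

text \<open>
  A finite simple graph is a \<^locale>\<open>pair_graph\<close>: a finite vertex set with a symmetric,
  irreflexive set of ordered pairs.  Each undirected edge appears as two opposite arcs, so
  the out-degree of a vertex is its degree in the undirected sense.
\<close>

definition min_degree :: "'a pair_pre_digraph \<Rightarrow> nat" where
  "min_degree G = Min (out_degree (with_proj G) ` pverts G)"

definition max_degree :: "'a pair_pre_digraph \<Rightarrow> nat" where
  "max_degree G = Max (out_degree (with_proj G) ` pverts G)"

text \<open>
  The library predicate \<^const>\<open>tree\<close> is about directed cycles and does not fit here: it counts
  the walk along an edge and back as a cycle.  In a simple graph the undirected cycles are
  exactly the directed cycles of length at least 3.
\<close>

definition undirected_cycle :: "'a pair_pre_digraph \<Rightarrow> ('a \<times> 'a) awalk \<Rightarrow> bool" where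
  "undirected_cycle G p \<longleftrightarrow> pre_digraph.cycle (with_proj G) p \<and> 3 \<le> length p"

definition undirected_tree :: "'a pair_pre_digraph \<Rightarrow> bool" where
  "undirected_tree T \<longleftrightarrow>
     pair_graph T \<and> Digraph_Component.connected (with_proj T) \<and> \<not> (\<exists>p. undirected_cycle T p)"

definition bounded_degree_trees :: "nat \<Rightarrow> nat \<Rightarrow> 'a pair_pre_digraph set" where
  "bounded_degree_trees n \<Delta> =
     {T. undirected_tree T \<and> card (pverts T) = n \<and> max_degree T \<le> \<Delta>}"

definition contains_copy :: "'a pair_pre_digraph \<Rightarrow> 'b pair_pre_digraph \<Rightarrow> bool" where
  "contains_copy G T \<longleftrightarrow>
     (\<exists>H :: 'a pair_pre_digraph.
        subgraph (with_proj H) (with_proj G) \<and> digraph_iso (with_proj T) (with_proj H))"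

end

theory Submission
  imports Defs
begin

text \<open>
  Choose an independent set \<open>I\<close> of low-degree vertices of the tree, embed the rest of the tree
  vertex by vertex along an order in which each vertex has at most one earlier neighbour, and
  finally match \<open>I\<close> to the unused vertices of the host graph.  The matching exists as soon as
  every unused vertex \<open>w\<close> is compatible with more than a few members of \<open>I\<close>.  A random greedy
  embedding guarantees this: each tree vertex \<open>p\<close> lands on a non-neighbour of \<open>w\<close> with
  probability at most \<open>q\<close>, about \<open>n powr (- (1 + \<epsilon>) / k)\<close>, and then spoils at most \<open>W\<close> members
  of \<open>I\<close>, where \<open>W\<close> bounds the number of neighbours in \<open>I\<close>.  The exponential moment of the
  number of spoiled members, with base \<open>1 / q\<close> and scale \<open>W\<close>, gives a failure probability of about
  \<open>q powr (card I / W)\<close>, which beats \<open>1 / n\<close> in both of the following cases, one of which always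
  occurs: either almost all vertices are leaves (\<open>W = \<Delta>\<close> and \<open>card I\<close> is nearly \<open>n\<close>, at least
  \<open>k \<Delta>\<close> up to the slack provided by \<open>\<epsilon>\<close>), or a positive proportion of the vertices have bounded
  degree and only neighbours of degree below \<open>\<Delta> / M\<close> for a large constant \<open>M\<close>.
\<close>

section \<open>Forests as one-degenerate relations: degree sums and colourings\<close>

text \<open>For symmetric irreflexive \<open>E\<close> on a finite \<open>V\<close> this
  characterises forests. Quantifying over all subsets makes the condition pass to the rest of the
  tree once \<open>I\<close> is deleted.\<close>

definition one_degenerate :: "('b \<Rightarrow> 'b \<Rightarrow> bool) \<Rightarrow> 'b set \<Rightarrow> bool" where
  "one_degenerate E V \<longleftrightarrow> (\<forall>S\<subseteq>V. S \<noteq> {} \<longrightarrow> (\<exists>v\<in>S. card {u\<in>S. E v u} \<le> 1))"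

lemma one_degenerate_subset: "one_degenerate E V \<Longrightarrow> S \<subseteq> V \<Longrightarrow> one_degenerate E S"
  unfolding one_degenerate_def by (meson subset_trans)

text \<open>Repeatedly removing a vertex with at most one remaining neighbour and reading the
  removals backwards gives an order in which each vertex has at most one earlier neighbour.\<close>

lemma one_degenerate_induct [consumes 2, case_names empty insert]:
  assumes "finite V" "one_degenerate E V"
    and "P {}"
    and step: "\<And>S v. S \<subseteq> V \<Longrightarrow> v \<in> V \<Longrightarrow> v \<notin> S \<Longrightarrow> card {u\<in>S. E v u} \<le> 1 \<Longrightarrow> P S \<Longrightarrow> P (insert v S)"
  shows "P V"
proof -
  have "S \<subseteq> V \<Longrightarrow> P S" if "finite S" for S
    using that
  proof (induction S rule: finite_psubset_induct)
    case (psubset S)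
    show ?case
    proof (cases "S = {}")
      case False
      then obtain v where v: "v \<in> S" "card {u\<in>S. E v u} \<le> 1"
        using assms(2) psubset.prems unfolding one_degenerate_def by blast
      have "card {u\<in>S-{v}. E v u} \<le> card {u\<in>S. E v u}"
        using psubset.hyps by (intro card_mono) auto
      moreover have "P (S - {v})" using v psubset by blast
      ultimately have "P (insert v (S - {v}))"
        using v psubset.prems by (intro step) auto
      then show ?thesis using v by (simp add: insert_absorb)
    qed (use \<open>P {}\<close> in simp)
  qed
  then show ?thesis using assms(1) by blast
qed

text \<open>Each vertex added in this order brings at most one edge, and an edge contributes 2 to
  the sum.\<close>

lemma degree_sum_le:
  assumes "finite V" "one_degenerate E V" and "symp E" "irreflp E"
  shows "(\<Sum>v\<in>V. card {u\<in>V. E v u}) \<le> 2 * card V"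
  using assms(1,2)
proof (induction rule: one_degenerate_induct)
  case (insert S v)
  note sym = sympD[OF \<open>symp E\<close>] and irr = irreflpD[OF \<open>irreflp E\<close>]
  have fS: "finite S" using insert.hyps(1) assms(1) finite_subset by blast
  have eq: "card {u\<in>insert v S. E x u} = card {u\<in>S. E x u} + (if E x v then 1 else 0)" for x
  proof -
    have "{u\<in>insert v S. E x u} = (if E x v then insert v {u\<in>S. E x u} else {u\<in>S. E x u})" by auto
    then show ?thesis using insert.hyps(3) fS by simp
  qed
  have "(\<Sum>x\<in>S. if E x v then 1 else 0::nat) = card {x\<in>S. E x v}"
    using fS by (simp add: sum.If_cases Int_def)
  also have "{x\<in>S. E x v} = {x\<in>S. E v x}" using sym by blast
  finally have "(\<Sum>x\<in>S. if E x v then 1 else 0::nat) \<le> 1" using insert.hyps(4) by simp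
  moreover have "(\<Sum>x\<in>insert v S. card {u\<in>insert v S. E x u})
      = card {u\<in>insert v S. E v u} + ((\<Sum>x\<in>S. card {u\<in>S. E x u}) + (\<Sum>x\<in>S. if E x v then 1 else 0))"
    unfolding sum.insert[OF fS insert.hyps(3)] sum.distrib[symmetric] by (simp only: eq)
  moreover have "card {u\<in>insert v S. E v u} \<le> 1"
    unfolding eq using insert.hyps(4) irr by simp
  ultimately show ?case using insert.IH insert.hyps(3) fS by simp
qed simp

text \<open>A new vertex takes the colour opposite to that of its only possible earlier neighbour,
  and \<open>True\<close> if there is none.\<close>

lemma two_colouring:
  assumes "finite V" "one_degenerate E V" and "symp E" "irreflp E"
  shows "\<exists>c::'b \<Rightarrow> bool. \<forall>u\<in>V. \<forall>v\<in>V. E u v \<longrightarrow> c u \<noteq> c v"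
  using assms(1,2)
proof (induction rule: one_degenerate_induct)
  case (insert S v)
  note sym = sympD[OF \<open>symp E\<close>] and irr = irreflpD[OF \<open>irreflp E\<close>]
  have fS: "finite S" using insert.hyps(1) assms(1) finite_subset by blast
  from insert.IH obtain c :: "'b \<Rightarrow> bool" where c: "\<forall>u\<in>S. \<forall>w\<in>S. E u w \<longrightarrow> c u \<noteq> c w" by blast
  have uniq: "u = w" if "u \<in> S" "w \<in> S" "E v u" "E v w" for u w
    using insert.hyps(4) that fS card_le_Suc0_iff_eq[of "{u\<in>S. E v u}"] by auto
  define c' where "c' = c(v := \<not> (\<exists>u\<in>S. E v u \<and> c u))"
  have new: "c' v \<noteq> c' w" if "w \<in> S" "E v w" for w
  proof -
    have "(\<exists>u\<in>S. E v u \<and> c u) \<longleftrightarrow> c w" using uniq that by blast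
    moreover have "w \<noteq> v" using that insert.hyps(3) by blast
    ultimately show ?thesis unfolding c'_def by simp
  qed
  have "c' u \<noteq> c' w" if "u \<in> insert v S" "w \<in> insert v S" "E u w" for u w
  proof (cases "u = v")
    case True
    then show ?thesis using that irr new by auto
  next
    case u: False
    then have "u \<in> S" using that by simp
    show ?thesis
    proof (cases "w = v")
      case True
      then show ?thesis using new[OF \<open>u \<in> S\<close>] sym[OF that(3)] by simp
    next
      case False
      then show ?thesis using u c that unfolding c'_def by simp
    qed
  qed
  then show ?case by (intro exI[of _ c'] ballI impI)
qed simp

text \<open>Take the larger colour class inside \<open>Y\<close>.\<close>

lemma independent_half:
  assumes "finite V" "one_degenerate E V" "symp E" "irreflp E" "Y \<subseteq> V"
  obtains I where "I \<subseteq> Y" "\<forall>u\<in>I. \<forall>v\<in>I. \<not> E u v" "card Y \<le> 2 * card I"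
proof -
  obtain c :: "'a \<Rightarrow> bool" where c: "\<forall>u\<in>V. \<forall>v\<in>V. E u v \<longrightarrow> c u \<noteq> c v"
    using two_colouring[OF assms(1-4)] by blast
  let ?A = "{y\<in>Y. c y}" and ?B = "{y\<in>Y. \<not> c y}"
  have "finite Y" using assms(1,5) finite_subset by blast
  then have "card Y = card ?A + card ?B"
    by (subst card_Un_disjoint[symmetric]) (auto intro: arg_cong[where f=card])
  then have "card Y \<le> 2 * card ?A \<or> card Y \<le> 2 * card ?B" by linarith
  then show thesis
  proof
    assume "card Y \<le> 2 * card ?A"
    with c assms(5) show thesis by (intro that[of ?A]) auto
  next
    assume "card Y \<le> 2 * card ?B"
    with c assms(5) show thesis by (intro that[of ?B]) auto
  qed
qed

section \<open>The derandomized greedy embedding\<close>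

lemma exists_le_average:
  fixes f :: "'c \<Rightarrow> real" and K :: real
  assumes "finite A" "A \<noteq> {}" "sum f A \<le> K * card A"
  shows "\<exists>x\<in>A. f x \<le> K"
proof (rule ccontr)
  assume "\<not> ?thesis"
  then have "(\<Sum>x\<in>A. K) < sum f A"
    using assms(1,2) by (intro sum_strict_mono) auto
  with assms(3) show False by (simp add: mult.commute)
qed

text \<open>
  The random greedy embedding, derandomized by conditional expectations: the sum over \<open>w\<close> is the
  exponential moment, and every image is chosen so that it grows by at most its average.
\<close>

lemma greedy_embedding:
  fixes U :: "'a set" and V :: "'b set" and c :: "'b \<Rightarrow> real" and d q :: real
  assumes U: "finite U" and "symp N"
    and nonnbrs: "\<And>x. x \<in> U \<Longrightarrow> card {y\<in>U. \<not> N x y} \<le> d"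
    and c: "\<And>p. p \<in> V \<Longrightarrow> 1 \<le> c p"
    and V: "finite V" "one_degenerate E V"
    and "symp E" "irreflp E"
    and d: "0 \<le> d" and q: "0 \<le> q" "d \<le> q * (real (card U) - real (card V) - d)" "real (card V) + d < real (card U)"
  shows "\<exists>\<phi>. inj_on \<phi> V \<and> \<phi> ` V \<subseteq> U \<and> (\<forall>u\<in>V. \<forall>v\<in>V. E u v \<longrightarrow> N (\<phi> u) (\<phi> v)) \<and>
    (\<Sum>w\<in>U. \<Prod>p\<in>V. if N (\<phi> p) w then 1 else c p) \<le> card U * (\<Prod>p\<in>V. 1 + q * (c p - 1))"
  using V
proof (induction rule: one_degenerate_induct)
  case empty
  show ?case by simp
next
  case (insert S v)
  note E_sym = sympD[OF \<open>symp E\<close>] and E_irr = irreflpD[OF \<open>irreflp E\<close>]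
    and N_sym = sympD[OF \<open>symp N\<close>]
  have fS: "finite S" using insert.hyps(1) V finite_subset by blast
  from insert.IH obtain \<phi> where \<phi>: "inj_on \<phi> S" "\<phi> ` S \<subseteq> U"
    "\<And>u w. u \<in> S \<Longrightarrow> w \<in> S \<Longrightarrow> E u w \<Longrightarrow> N (\<phi> u) (\<phi> w)"
    and pot: "(\<Sum>w\<in>U. \<Prod>p\<in>S. if N (\<phi> p) w then 1 else c p) \<le> card U * (\<Prod>p\<in>S. 1 + q * (c p - 1))"
    by blast
  \<comment> \<open>\<open>F w\<close> is the current weight of \<open>w\<close>: a factor
    \<open>c p\<close> for every embedded \<open>p\<close> that missed the neighbourhood of
    \<open>w\<close>.\<close>
  define F where "F w = (\<Prod>p\<in>S. if N (\<phi> p) w then 1 else c p)" for w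
  have F: "F w \<ge> 0" for w
    unfolding F_def using c insert.hyps(1) by (intro prod_nonneg) force
  define A where "A = {x\<in>U - \<phi> ` S. \<forall>u\<in>S. E v u \<longrightarrow> N (\<phi> u) x}"
  have fA: "finite A" unfolding A_def using U by auto
  \<comment> \<open>At most one neighbour \<open>u\<close> of \<open>v\<close> is embedded, so only
    the non-neighbours of \<open>\<phi> u\<close> are lost.\<close>
  have "card (U - \<phi> ` S - A) \<le> d"
  proof (cases "\<exists>u\<in>S. E v u")
    case True
    then obtain u where u: "u \<in> S" "E v u" by blast
    have "w = u" if "w \<in> S" "E v w" for w
      using insert.hyps(4) that u fS card_le_Suc0_iff_eq[of "{u\<in>S. E v u}"] by auto
    then have "U - \<phi> ` S - A \<subseteq> {y\<in>U. \<not> N (\<phi> u) y}" unfolding A_def by auto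
    then have "card (U - \<phi> ` S - A) \<le> card {y\<in>U. \<not> N (\<phi> u) y}" using U by (intro card_mono) auto
    then have "real (card (U - \<phi> ` S - A)) \<le> real (card {y\<in>U. \<not> N (\<phi> u) y})" by simp
    also have "\<dots> \<le> d" using u(1) \<phi>(2) by (intro nonnbrs) auto
    finally show ?thesis .
  next
    case False
    then have empty: "U - \<phi> ` S - A = {}" unfolding A_def by auto
    show ?thesis unfolding empty using d by simp
  qed
  moreover have "card U \<le> card (\<phi> ` S) + card A + card (U - \<phi> ` S - A)"
  proof -
    have "card U \<le> card (\<phi> ` S \<union> A \<union> (U - \<phi> ` S - A))" using U fS fA by (intro card_mono) auto
    also have "\<dots> \<le> card (\<phi> ` S) + card A + card (U - \<phi> ` S - A)"
      by (meson add_mono_thms_linordered_semiring(3) card_Un_le dual_order.trans)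
    finally show ?thesis .
  qed
  moreover have "card (\<phi> ` S) \<le> card V"
    using card_image_le[OF fS, of \<phi>] card_mono[OF V(1) insert.hyps(1)] by simp
  ultimately have cA: "card A \<ge> real (card U) - real (card V) - d" by linarith
  then have A0: "A \<noteq> {}" using q(3) by auto
  \<comment> \<open>For every \<open>w\<close>, at most a fraction \<open>q\<close> of
    \<open>A\<close> consists of non-neighbours of \<open>w\<close>.\<close>
  have dA: "d \<le> q * card A" using q cA mult_left_mono[OF cA q(1)] by linarith
  define b where "b = c v - 1"
  have b: "b \<ge> 0" unfolding b_def using c insert.hyps by simp
  define K where "K = (1 + q * b) * (\<Sum>w\<in>U. F w)"
  \<comment> \<open>Averaged over \<open>x\<close> in \<open>A\<close>, the weight of a fixed
    \<open>w\<close> grows by a factor of at most \<open>1 + q * b\<close>, and \<open>K\<close>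
    bounds the resulting average of the total.\<close>
  have "(\<Sum>x\<in>A. \<Sum>w\<in>U. F w * (if N x w then 1 else c v)) = (\<Sum>w\<in>U. F w * (\<Sum>x\<in>A. if N x w then 1 else c v))"
    by (subst sum.swap) (simp add: sum_distrib_left)
  also have "\<dots> \<le> (\<Sum>w\<in>U. F w * ((1 + q * b) * card A))"
  proof (intro sum_mono mult_left_mono F)
    fix w assume w: "w \<in> U"
    have "(\<Sum>x\<in>A. if N x w then 1 else c v) = (\<Sum>x\<in>A. 1 + (if N x w then 0 else b))"
      unfolding b_def by (intro sum.cong) auto
    also have "\<dots> = card A + b * card {x\<in>A. \<not> N x w}"
      using fA by (simp add: sum.distrib sum.If_cases Int_def mult.commute)
    also have "{x\<in>A. \<not> N x w} \<subseteq> {y\<in>U. \<not> N w y}" unfolding A_def using N_sym by blast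
    then have "card {x\<in>A. \<not> N x w} \<le> card {y\<in>U. \<not> N w y}"
      using U by (intro card_mono) auto
    then have "card {x\<in>A. \<not> N x w} \<le> d" using nonnbrs[OF w] by linarith
    then have "b * card {x\<in>A. \<not> N x w} \<le> b * (q * card A)" using b dA by (intro mult_left_mono) auto
    finally show "(\<Sum>x\<in>A. if N x w then 1 else c v) \<le> (1 + q * b) * card A"
      by (simp add: algebra_simps)
  qed
  also have "\<dots> = K * card A" unfolding K_def by (simp add: sum_distrib_right sum_distrib_left mult_ac)
  finally obtain x where x: "x \<in> A" "(\<Sum>w\<in>U. F w * (if N x w then 1 else c v)) \<le> K"
    using exists_le_average[OF fA A0] by blast
  define \<psi> where "\<psi> = \<phi>(v := x)"
  have \<psi>S: "\<psi> u = \<phi> u" if "u \<in> S" for u using that insert.hyps(3) unfolding \<psi>_def by auto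
  have \<psi>v: "\<psi> v = x" unfolding \<psi>_def by simp
  have im: "\<psi> ` S = \<phi> ` S" using \<psi>S by auto
  have "inj_on \<psi> (insert v S)"
    using \<phi>(1) \<psi>S x(1) insert.hyps(3) im \<psi>v inj_on_cong[of S \<psi> \<phi>] unfolding A_def by auto
  moreover have "\<psi> ` insert v S \<subseteq> U" using im \<phi>(2) x(1) \<psi>v unfolding A_def by auto
  moreover have "\<forall>u\<in>insert v S. \<forall>w\<in>insert v S. E u w \<longrightarrow> N (\<psi> u) (\<psi> w)"
  proof -
    have old: "N (\<psi> u) (\<psi> w)" if "u \<in> S" "w \<in> S" "E u w" for u w
      using that \<phi>(3) \<psi>S by simp
    have new: "N (\<psi> u) (\<psi> v)" if "u \<in> S" "E v u" for u
      using that x(1) \<psi>S \<psi>v unfolding A_def by simp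
    show ?thesis using old new E_irr E_sym N_sym by (metis insertE)
  qed
  moreover have "(\<Sum>w\<in>U. \<Prod>p\<in>insert v S. if N (\<psi> p) w then 1 else c p) \<le> card U * (\<Prod>p\<in>insert v S. 1 + q * (c p - 1))"
  proof -
    have "(\<Sum>w\<in>U. \<Prod>p\<in>insert v S. if N (\<psi> p) w then 1 else c p) = (\<Sum>w\<in>U. F w * (if N x w then 1 else c v))"
      using fS insert.hyps(3) \<psi>S unfolding F_def by (intro sum.cong refl) (simp add: \<psi>v mult.commute)
    also have "\<dots> \<le> (1 + q * b) * (card U * (\<Prod>p\<in>S. 1 + q * (c p - 1)))"
      using x(2) pot q(1) b mult_left_mono[OF pot, of "1 + q * b"] unfolding K_def F_def by simp
    finally show ?thesis using fS insert.hyps(3) unfolding b_def by (simp add: mult_ac)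
  qed
  ultimately show ?case by blast
qed

section \<open>From a dense matching to a spanning embedding\<close>

text \<open>
  In a bijection with the fewest bad pairs, a bad pair could be repaired by a single swap.
\<close>

lemma dense_perfect_matching:
  fixes I :: "'b set" and R :: "'a set"
  assumes fin: "finite I" "finite R" "card I = card R"
    and left: "\<And>i. i \<in> I \<Longrightarrow> real (card {w\<in>R. \<not> M i w}) \<le> t"
    and right: "\<And>w. w \<in> R \<Longrightarrow> t < real (card {i\<in>I. M i w})"
  shows "\<exists>f. bij_betw f I R \<and> (\<forall>i\<in>I. M i (f i))"
proof -
  define bad where "bad f = card {i\<in>I. \<not> M i (f i)}" for f
  obtain f0 where "bij_betw f0 I R" using finite_same_card_bij[OF fin] by blast
  then obtain f where f: "bij_betw f I R" and min: "\<And>g. bij_betw g I R \<Longrightarrow> bad f \<le> bad g"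
    using ex_has_least_nat[of "\<lambda>f. bij_betw f I R" f0 bad] by blast
  have "M i (f i)" if i: "i \<in> I" for i
  proof (rule ccontr)
    assume nM: "\<not> M i (f i)"
    have inj: "inj_on f I" and im: "f ` I = R" using f by (auto simp: bij_betw_def)
    have "f ` {j\<in>I. \<not> M i (f j)} \<subseteq> {w\<in>R. \<not> M i w}" using im by auto
    then have "card {j\<in>I. \<not> M i (f j)} \<le> card {w\<in>R. \<not> M i w}"
      using fin inj_on_subset[OF inj] by (intro card_inj_on_le[of f]) auto
    \<comment> \<open>More than \<open>t\<close> members accept \<open>f i\<close>, while at most
      \<open>t\<close> members hold an image unsuitable for \<open>i\<close>. So some
      \<open>j\<close> accepts \<open>f i\<close> and holds an image that suits
      \<open>i\<close>.\<close>
    with left[OF i] right[of "f i"] i im have "card {j\<in>I. \<not> M i (f j)} < card {j\<in>I. M j (f i)}" by force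
    then have "\<not> {j\<in>I. M j (f i)} \<subseteq> {j\<in>I. \<not> M i (f j)}"
      using fin(1) card_mono[of "{j\<in>I. \<not> M i (f j)}" "{j\<in>I. M j (f i)}"] by force
    then obtain j where j: "j \<in> I" "M j (f i)" "M i (f j)" by auto
    define g where "g = f \<circ> Transposition.transpose i j"
    have "bij_betw (Transposition.transpose i j) I I"
      using i j(1) by (auto simp: bij_betw_def inj_on_def transpose_def image_iff split: if_splits)
    then have "bij_betw g I R" unfolding g_def using f bij_betw_trans by blast
    then have "bad f \<le> bad g" by (rule min)
    \<comment> \<open>The swap makes both \<open>i\<close> and \<open>j\<close> good and changes
      nothing else, and \<open>i\<close> was bad before.\<close>
    moreover have "{l\<in>I. \<not> M l (g l)} \<subset> {l\<in>I. \<not> M l (f l)}"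
      using i j nM unfolding g_def by (auto simp: transpose_def split: if_splits)
    then have "bad g < bad f" unfolding bad_def using fin(1) by (intro psubset_card_mono) auto
    ultimately show False by simp
  qed
  then show ?thesis using f by blast
qed

text \<open>A convex function lies below its chord. The inequality is weighted AM-GM for
  \<open>b\<close> and 1, obtained from \<open>ln x \<le> x - 1\<close> at \<open>b / y\<close> and
  \<open>1 / y\<close>, where \<open>y\<close> is their weighted mean.\<close>

lemma powr_le_one_plus:
  fixes b t :: real
  assumes "1 \<le> b" "0 \<le> t" "t \<le> 1"
  shows "b powr t \<le> 1 + t * (b - 1)"
proof -
  define y where "y = 1 + t * (b - 1)"
  have y: "0 < y" unfolding y_def using assms by (intro add_pos_nonneg) auto
  have "t * ln (b / y) + (1 - t) * ln (1 / y) \<le> t * (b / y - 1) + (1 - t) * (1 / y - 1)"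
    using assms y by (intro add_mono mult_left_mono ln_le_minus_one) auto
  also have "\<dots> = 0" using y unfolding y_def by (simp add: field_simps)
  finally have "t * ln b \<le> ln y" using assms y by (simp add: ln_div algebra_simps)
  then have "exp (t * ln b) \<le> y" using y by (simp add: ln_ge_iff)
  then show ?thesis unfolding y_def powr_def using assms by simp
qed

text \<open>After \<open>V - I\<close> is embedded greedily, \<open>main\<close> makes the
  exponential moment too small for any free \<open>w\<close> to be spoiled for
  \<open>card I - D * d\<close> members of \<open>I\<close>. So more than \<open>D * d\<close>
  members remain compatible with \<open>w\<close>, which is the threshold for the matching.\<close>

lemma spanning_embedding:
  fixes U :: "'a set" and V I :: "'b set" and d D q W :: real
  assumes U: "finite U" and "symp N"
    and nonnbrs: "\<And>x. x \<in> U \<Longrightarrow> card {y\<in>U. \<not> N x y} \<le> d"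
    and V: "finite V" "one_degenerate E V" and UV: "card V = card U"
    and "symp E" "irreflp E"
    and I: "I \<subseteq> V" "\<forall>u\<in>I. \<forall>v\<in>I. \<not> E u v"
    and D: "\<And>i. i \<in> I \<Longrightarrow> card {p\<in>V. E i p} \<le> D"
    and W: "0 < W" "\<And>p. p \<in> V \<Longrightarrow> card {i\<in>I. E p i} \<le> W"
    and d: "0 \<le> d" "d < card I" and q: "0 < q" "q < 1" "d \<le> q * (card I - d)"
    and main: "card U * exp (D * card I / W) < (1 / q) powr ((card I - D * d) / W)"
  shows "\<exists>f. bij_betw f V U \<and> (\<forall>u\<in>V. \<forall>v\<in>V. E u v \<longrightarrow> N (f u) (f v))"
proof -
  note E_sym = sympD[OF \<open>symp E\<close>] and N_sym = sympD[OF \<open>symp N\<close>]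
  let ?S = "V - I"
  have fI: "finite I" and fS: "finite ?S" using I V finite_subset by blast+
  have cS: "real (card ?S) = real (card U) - real (card I)"
    using card_Diff_subset[OF fI I(1)] card_mono[OF V(1) I(1)] UV by simp
  define k where "k p = real (card {i\<in>I. E p i})" for p
  \<comment> \<open>An image of \<open>p\<close> outside the neighbourhood of \<open>w\<close>
    spoils \<open>w\<close> for the \<open>k p\<close> neighbours of \<open>p\<close> in
    \<open>I\<close>. The base \<open>1 / q\<close> offsets the probability \<open>q\<close>, so the
    mean factor is at most \<open>1 + k p / W\<close>.\<close>
  define c where "c p = (1 / q) powr (k p / W)" for p
  have k: "0 \<le> k p / W" for p unfolding k_def using W(1) by simp
  have kW: "k p / W \<le> 1" if "p \<in> V" for p unfolding k_def using W that by simp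
  have "1 \<le> c p" for p unfolding c_def using k q by (intro ge_one_powr_ge_zero) auto
  then have "\<exists>\<phi>. inj_on \<phi> ?S \<and> \<phi> ` ?S \<subseteq> U \<and> (\<forall>u\<in>?S. \<forall>v\<in>?S. E u v \<longrightarrow> N (\<phi> u) (\<phi> v)) \<and>
    (\<Sum>w\<in>U. \<Prod>p\<in>?S. if N (\<phi> p) w then 1 else c p) \<le> card U * (\<Prod>p\<in>?S. 1 + q * (c p - 1))"
    using d q cS by (intro greedy_embedding[OF U \<open>symp N\<close> nonnbrs _ fS one_degenerate_subset[OF V(2)] \<open>symp E\<close> \<open>irreflp E\<close>]) auto
  then obtain \<phi> where \<phi>: "inj_on \<phi> ?S" "\<phi> ` ?S \<subseteq> U"
    "\<And>u v. u \<in> ?S \<Longrightarrow> v \<in> ?S \<Longrightarrow> E u v \<Longrightarrow> N (\<phi> u) (\<phi> v)"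
    and pot: "(\<Sum>w\<in>U. \<Prod>p\<in>?S. if N (\<phi> p) w then 1 else c p) \<le> card U * (\<Prod>p\<in>?S. 1 + q * (c p - 1))"
    by blast
  have "(\<Prod>p\<in>?S. 1 + q * (c p - 1)) \<le> (\<Prod>p\<in>?S. exp (k p / W))"
  proof (intro prod_mono conjI)
    fix p assume p: "p \<in> ?S"
    show "0 \<le> 1 + q * (c p - 1)" using q \<open>1 \<le> c p\<close> by simp
    have "c p \<le> 1 + k p / W * (1 / q - 1)"
      unfolding c_def using p q k kW by (intro powr_le_one_plus) auto
    then have "q * (c p - 1) \<le> q * (k p / W * (1 / q - 1))" using q by (intro mult_left_mono) auto
    also have "\<dots> = k p / W * (1 - q)" using q W(1) by (simp add: field_simps)
    also have "\<dots> \<le> k p / W * 1" using k q by (intro mult_left_mono) auto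
    finally show "1 + q * (c p - 1) \<le> exp (k p / W)" using exp_ge_add_one_self[of "k p / W"] by linarith
  qed
  also have "\<dots> = exp ((\<Sum>p\<in>?S. k p) / W)"
    using fS by (simp add: exp_sum sum_divide_distrib)
  also have "\<dots> \<le> exp (D * card I / W)"
  proof -
    \<comment> \<open>Double counting of the edges between \<open>V - I\<close> and
      \<open>I\<close>.\<close>
    have "(\<Sum>p\<in>?S. k p) = (\<Sum>p\<in>?S. \<Sum>i\<in>I. if E p i then 1 else 0)"
      unfolding k_def using fI by (simp add: sum.If_cases Int_def)
    also have "\<dots> = (\<Sum>i\<in>I. \<Sum>p\<in>?S. if E p i then 1 else 0)" by (rule sum.swap)
    also have "\<dots> \<le> (\<Sum>i\<in>I. D)"
    proof (intro sum_mono)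
      fix i assume i: "i \<in> I"
      have "(\<Sum>p\<in>?S. if E p i then 1 else 0::real) = card {p\<in>?S. E p i}"
        using fS by (simp add: sum.If_cases Int_def)
      also have "{p\<in>?S. E p i} \<subseteq> {p\<in>V. E i p}" using E_sym by blast
      then have "card {p\<in>?S. E p i} \<le> card {p\<in>V. E i p}" using V(1) by (intro card_mono) auto
      finally show "(\<Sum>p\<in>?S. if E p i then 1 else 0) \<le> D" using D[OF i] by simp
    qed
    finally show ?thesis using W(1) by (simp add: divide_right_mono mult.commute)
  qed
  finally have "card U * (\<Prod>p\<in>?S. 1 + q * (c p - 1)) \<le> card U * exp (D * card I / W)"
    by (intro mult_left_mono) auto
  with pot main have pot_less: "(\<Sum>w\<in>U. \<Prod>p\<in>?S. if N (\<phi> p) w then 1 else c p) < (1 / q) powr ((card I - D * d) / W)"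
    by linarith
  define R where "R = U - \<phi> ` ?S"
  \<comment> \<open>As \<open>I\<close> is independent, all neighbours of \<open>i\<close> lie in
    \<open>?S\<close>, so \<open>M i w\<close> says exactly that \<open>w\<close> may serve as the
    image of \<open>i\<close>.\<close>
  define M where "M i w = (\<forall>p\<in>?S. E i p \<longrightarrow> N (\<phi> p) w)" for i w
  have "card R = card U - card (\<phi> ` ?S)" unfolding R_def using fS \<phi>(2) by (intro card_Diff_subset) auto
  moreover have "card (\<phi> ` ?S) = card ?S" using \<phi>(1) by (rule card_image)
  ultimately have "card I = card R" using cS by linarith
  moreover have "real (card {w\<in>R. \<not> M i w}) \<le> D * d" if i: "i \<in> I" for i
  proof -
    let ?P = "{p\<in>?S. E i p}"
    have "{w\<in>R. \<not> M i w} \<subseteq> (\<Union>p\<in>?P. {w\<in>U. \<not> N (\<phi> p) w})" unfolding M_def R_def by auto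
    then have "card {w\<in>R. \<not> M i w} \<le> card (\<Union>p\<in>?P. {w\<in>U. \<not> N (\<phi> p) w})"
      using V(1) U by (intro card_mono) auto
    also have "\<dots> \<le> (\<Sum>p\<in>?P. card {w\<in>U. \<not> N (\<phi> p) w})"
      using V(1) by (intro card_UN_le) auto
    finally have "real (card {w\<in>R. \<not> M i w}) \<le> (\<Sum>p\<in>?P. real (card {w\<in>U. \<not> N (\<phi> p) w}))"
      by (simp flip: of_nat_sum)
    also have "\<dots> \<le> (\<Sum>p\<in>?P. d)" using \<phi>(2) by (intro sum_mono nonnbrs) auto
    also have "\<dots> = card ?P * d" by simp
    also have "\<dots> \<le> D * d"
    proof (intro mult_right_mono d)
      have "card ?P \<le> card {p\<in>V. E i p}" using V(1) by (intro card_mono) auto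
      then show "card ?P \<le> D" using D[OF i] by linarith
    qed
    finally show ?thesis .
  qed
  moreover have "D * d < real (card {i\<in>I. M i w})" if w: "w \<in> R" for w
  proof -
    let ?B = "{p\<in>?S. \<not> N (\<phi> p) w}"
    have fB: "finite ?B" using V(1) by auto
    \<comment> \<open>The weight of \<open>w\<close> is a single summand of the potential; comparing
      exponents bounds the number of spoiled members.\<close>
    have "(1 / q) powr ((\<Sum>p\<in>?B. k p) / W) = (\<Prod>p\<in>?B. c p)"
      unfolding c_def sum_divide_distrib using q fB by (simp add: powr_sum)
    also have "\<dots> = (\<Prod>p\<in>?S. if N (\<phi> p) w then 1 else c p)"
      using fS by (simp add: prod.If_cases Int_def)
    also have "\<dots> \<le> (\<Sum>w\<in>U. \<Prod>p\<in>?S. if N (\<phi> p) w then 1 else c p)"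
      using U w \<open>\<And>p. 1 \<le> c p\<close> unfolding R_def
      by (intro member_le_sum prod_nonneg) (auto intro: order_trans[OF zero_le_one])
    also note pot_less
    finally have "(\<Sum>p\<in>?B. k p) / W < (card I - D * d) / W" using q by simp
    then have less: "(\<Sum>p\<in>?B. k p) < card I - D * d" using W(1) by (simp add: divide_less_cancel)
    have "{i\<in>I. \<not> M i w} \<subseteq> (\<Union>p\<in>?B. {i\<in>I. E p i})" unfolding M_def using E_sym by blast
    then have "card {i\<in>I. \<not> M i w} \<le> card (\<Union>p\<in>?B. {i\<in>I. E p i})"
      using fI fB by (intro card_mono) auto
    also have "\<dots> \<le> (\<Sum>p\<in>?B. card {i\<in>I. E p i})"
      using fB by (rule card_UN_le)
    finally have "real (card {i\<in>I. \<not> M i w}) \<le> (\<Sum>p\<in>?B. k p)"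
      unfolding k_def by (simp flip: of_nat_sum)
    moreover have "card I = card {i\<in>I. M i w} + card {i\<in>I. \<not> M i w}"
      using fI by (subst card_Un_disjoint[symmetric]) (auto intro: arg_cong[where f=card])
    ultimately show ?thesis using less by linarith
  qed
  moreover have "finite R" unfolding R_def using U by simp
  ultimately obtain g where g: "bij_betw g I R" "\<And>i. i \<in> I \<Longrightarrow> M i (g i)"
    using dense_perfect_matching[of I R M "D * d"] fI by blast
  define f where "f p = (if p \<in> I then g p else \<phi> p)" for p
  have "bij_betw f I R" using g(1) bij_betw_cong[of I f g R] unfolding f_def by simp
  moreover have "bij_betw f ?S (\<phi> ` ?S)"
    using bij_betw_cong[of ?S f \<phi>] inj_on_imp_bij_betw[OF \<phi>(1)] unfolding f_def by simp
  ultimately have "bij_betw f (I \<union> ?S) (R \<union> \<phi> ` ?S)" unfolding R_def by (intro bij_betw_combine) auto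
  moreover have "I \<union> ?S = V" "R \<union> \<phi> ` ?S = U" using I \<phi>(2) unfolding R_def by auto
  ultimately have "bij_betw f V U" by simp
  moreover have "N (f u) (f v)" if uv: "u \<in> V" "v \<in> V" "E u v" for u v
  proof -
    have *: "N (f u) (f v)" if "u \<in> ?S" "v \<in> I" "E v u" for u v
      using g(2)[OF that(2)] that unfolding M_def f_def by simp
    show ?thesis
    proof (cases "u \<in> I"; cases "v \<in> I")
      assume "u \<in> I" "v \<in> I"
      then show ?thesis using I uv by blast
    next
      assume "u \<in> I" "v \<notin> I"
      then show ?thesis using *[of v u] N_sym uv by blast
    next
      assume "u \<notin> I" "v \<in> I"
      then show ?thesis using *[of u v] E_sym uv by blast
    next
      assume "u \<notin> I" "v \<notin> I"
      then show ?thesis using \<phi>(3) uv unfolding f_def by simp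
    qed
  qed
  ultimately show ?thesis by blast
qed

section \<open>The choice of the independent set\<close>

text \<open>
  If few vertices avoid the set \<open>X\<close> of high-degree vertices and its neighbourhood \<open>Z\<close>, then the
  degrees over \<open>X\<close> already sum to at least \<open>card Z\<close>, close to \<open>card V\<close>.  As all degrees sum to at
  most \<open>2 * card V\<close>, few vertices of \<open>Z\<close> can have degree above 1.
\<close>

lemma independent_set_dichotomy:
  fixes V :: "'b set" and \<eta> s :: real
  assumes V: "finite V" "one_degenerate E V"
    and E: "symp E" "irreflp E"
    and \<eta>: "0 < \<eta>" and s: "6 \<le> \<eta> * s"
  obtains I where "I \<subseteq> V" "\<forall>u\<in>I. \<forall>v\<in>I. \<not> E u v" "\<eta> / 4 * card V \<le> card I"
      "\<And>i. i \<in> I \<Longrightarrow> card {p\<in>V. E i p} \<le> 4 / \<eta>" "\<And>p. p \<in> V \<Longrightarrow> card {i\<in>I. E p i} \<le> s"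
  | I where "I \<subseteq> V" "\<forall>u\<in>I. \<forall>v\<in>I. \<not> E u v" "(1 - 4 * \<eta>) * card V \<le> card I"
      "\<And>i. i \<in> I \<Longrightarrow> card {p\<in>V. E i p} \<le> 1"
proof -
  note E_sym = sympD[OF E(1)]
  define deg where "deg v = card {u\<in>V. E v u}" for v
  have deg_sum: "(\<Sum>v\<in>V. deg v) \<le> 2 * card V"
    unfolding deg_def by (rule degree_sum_le[OF V E])
  have many: "real (card {v\<in>V. a \<le> deg v}) * a \<le> 2 * card V" for a :: real
  proof -
    let ?A = "{v\<in>V. a \<le> deg v}"
    have "real (card ?A) * a = (\<Sum>v\<in>?A. a)" by simp
    also have "\<dots> \<le> (\<Sum>v\<in>?A. real (deg v))" by (intro sum_mono) auto
    also have "\<dots> \<le> (\<Sum>v\<in>V. real (deg v))" using V(1) by (intro sum_mono2) auto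
    also have "\<dots> = real (\<Sum>v\<in>V. deg v)" by simp
    also have "\<dots> \<le> 2 * card V" using deg_sum by (smt (verit) of_nat_mono of_nat_mult of_nat_numeral)
    finally show ?thesis .
  qed
  \<comment> \<open>\<open>X\<close> holds the high-degree vertices, \<open>Z\<close> their
    neighbours outside \<open>X\<close>, and \<open>Y\<close> the vertices far from
    \<open>X\<close>.\<close>
  define X where "X = {v\<in>V. s \<le> deg v}"
  define Z where "Z = {v\<in>V - X. \<exists>x\<in>X. E x v}"
  define Y where "Y = V - X - Z"
  have fin: "finite X" "finite Z" "finite Y" unfolding X_def Y_def Z_def using V(1) by auto
  have split: "card V = card X + card Y + card Z"
  proof -
    have "V = (X \<union> Y) \<union> Z" unfolding Y_def Z_def X_def by auto
    moreover have "card ((X \<union> Y) \<union> Z) = card (X \<union> Y) + card Z" "card (X \<union> Y) = card X + card Y"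
      using fin by (auto intro!: card_Un_disjoint simp: Y_def Z_def)
    ultimately show ?thesis by simp
  qed
  have cX: "3 * card X \<le> \<eta> * card V"
  proof -
    have "real (card X) * 6 \<le> card X * (\<eta> * s)" using s by (intro mult_left_mono) auto
    also have "\<dots> = \<eta> * (card X * s)" by simp
    also have "\<dots> \<le> \<eta> * (2 * card V)" unfolding X_def using \<eta> many by (intro mult_left_mono) auto
    finally show ?thesis by simp
  qed
  show thesis
  proof (cases "\<eta> * card V \<le> card Y")
    case True
    \<comment> \<open>Discarding \<open>?H\<close> costs at most half of the guaranteed size of
      \<open>Y\<close>, and passing to an independent subset at most another half, which leaves
      \<open>\<eta> / 4\<close>.\<close>
    let ?H = "{v\<in>V. 4 / \<eta> \<le> deg v}"
    let ?Y = "Y - ?H"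
    have "card ?H \<le> \<eta> / 2 * card V" using many[of "4 / \<eta>"] \<eta> by (simp add: field_simps)
    moreover have "card Y - card ?H \<le> card ?Y" using V(1) by (intro diff_card_le_card_Diff) auto
    ultimately have "\<eta> / 2 * card V \<le> card ?Y" using True \<eta> by linarith
    moreover obtain I where I: "I \<subseteq> ?Y" "\<forall>u\<in>I. \<forall>v\<in>I. \<not> E u v" "card ?Y \<le> 2 * card I"
      using independent_half[OF V E, of ?Y] Y_def by blast
    ultimately have "\<eta> / 4 * card V \<le> card I" by linarith
    moreover have "card {p\<in>V. E i p} \<le> 4 / \<eta>" if "i \<in> I" for i
      using that I(1) unfolding deg_def[symmetric] Y_def by force
    moreover have "card {i\<in>I. E p i} \<le> s" if p: "p \<in> V" for p
    proof (cases "p \<in> X")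
      case True
      then have "{i\<in>I. E p i} = {}" using I(1) unfolding Y_def Z_def by auto
      moreover have "0 \<le> s" using s \<eta> by (smt (verit) mult_nonneg_nonpos)
      ultimately show ?thesis by (metis card.empty of_nat_0)
    next
      case False
      then have "deg p < s" using p unfolding X_def by auto
      moreover have "card {i\<in>I. E p i} \<le> deg p"
        unfolding deg_def using I(1) V(1) unfolding Y_def by (intro card_mono) auto
      ultimately show ?thesis by simp
    qed
    ultimately show thesis using I by (intro that(1)[of I]) (auto simp: Y_def)
  next
    case False
    define L where "L = {z\<in>Z. deg z \<le> 1}"
    have LZ: "L \<subseteq> Z" "finite L" unfolding L_def using fin by auto
    have "card Z \<le> card (\<Union>x\<in>X. {u\<in>V. E x u})" using fin V(1) unfolding Z_def by (intro card_mono) auto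
    also have "\<dots> \<le> (\<Sum>x\<in>X. deg x)" unfolding deg_def using fin by (intro card_UN_le) auto
    finally have sX: "card Z \<le> (\<Sum>x\<in>X. deg x)" .
    have pos: "1 \<le> deg z" if z: "z \<in> Z" for z
    proof -
      obtain x where "x \<in> {u\<in>V. E z u}" using z E_sym unfolding Z_def X_def by blast
      then have "{u\<in>V. E z u} \<noteq> {}" by blast
      then show ?thesis unfolding deg_def using V(1) by (simp add: Suc_leI card_gt_0_iff)
    qed
    \<comment> \<open>Every vertex of \<open>Z\<close> has degree at least 1, and at least 2 outside
      \<open>L\<close>.\<close>
    have "card Z + card (Z - L) = (\<Sum>z\<in>Z. 1 + (if z \<in> Z - L then 1 else 0))"
      using fin unfolding sum.distrib by (simp add: sum.If_cases Int_def) (auto intro: arg_cong[where f=card])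
    also have "\<dots> \<le> (\<Sum>z\<in>Z. deg z)"
      using pos unfolding L_def by (intro sum_mono) force
    finally have sZ: "card Z + card (Z - L) \<le> (\<Sum>z\<in>Z. deg z)" .
    have "(\<Sum>x\<in>X. deg x) + (\<Sum>z\<in>Z. deg z) = (\<Sum>v\<in>X \<union> Z. deg v)"
      using fin by (intro sum.union_disjoint[symmetric]) (auto simp: Z_def)
    also have "\<dots> \<le> (\<Sum>v\<in>V. deg v)" using V(1) by (intro sum_mono2) (auto simp: X_def Z_def)
    finally have "2 * card Z + card (Z - L) \<le> 2 * card V" using sX sZ deg_sum by linarith
    moreover have "card (Z - L) = card Z - card L" "card L \<le> card Z"
      using card_Diff_subset[OF LZ(2,1)] card_mono[OF fin(2) LZ(1)] by simp_all
    \<comment> \<open>Substitute \<open>card Z = card V - card X - card Y\<close> into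
      \<open>3 * card Z \<le> 2 * card V + card L\<close>. Below, \<open>3 * card X\<close> costs
      one \<open>\<eta> * card V\<close> and \<open>3 * card Y\<close> costs three.\<close>
    ultimately have "card V \<le> card L + 3 * (card X + card Y)" using split by simp
    then have "real (card V) \<le> real (card L + 3 * (card X + card Y))" by (simp only: of_nat_le_iff)
    then have "real (card V) \<le> card L + 3 * card X + 3 * card Y" by simp
    then have "(1 - 4 * \<eta>) * card V \<le> card L" using cX False by (simp add: algebra_simps)
    \<comment> \<open>The only neighbour of a vertex of \<open>L\<close> lies in \<open>X\<close>,
      which is disjoint from \<open>L\<close>.\<close>
    moreover have "\<not> E u v" if u: "u \<in> L" "v \<in> L" for u v
    proof
      assume "E u v"
      obtain x where x: "x \<in> X" "E u x" using u E_sym unfolding L_def Z_def by blast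
      then have "{x, v} \<subseteq> {w\<in>V. E u w}" using u \<open>E u v\<close> unfolding L_def Z_def X_def by auto
      moreover have "x \<noteq> v" using x u unfolding L_def Z_def by auto
      then have "card {x, v} = 2" by simp
      ultimately have "2 \<le> deg u" unfolding deg_def using V(1) card_mono[of "{w\<in>V. E u w}" "{x, v}"] by simp
      then show False using u unfolding L_def by auto
    qed
    moreover have "card {p\<in>V. E i p} \<le> 1" if "i \<in> L" for i
      using that unfolding deg_def[symmetric] L_def by auto
    moreover have "L \<subseteq> V" using LZ unfolding Z_def by auto
    ultimately show thesis by (intro that(2)[of L]) auto
  qed
qed

section \<open>Numerical parameters\<close>

text \<open>Provides the numerical hypotheses of \<open>spanning_embedding\<close> with
  \<open>m = card I\<close> and \<open>W = \<Delta> / M\<close>. Up to constants,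
  \<open>1 / q\<close> is \<open>n powr ((1 + \<epsilon>) / k)\<close> and the exponent is at least
  \<open>\<gamma> * M * k\<close>, so the right side exceeds \<open>n\<close> by a power of
  \<open>n\<close>. The exponential on the left is only \<open>exp (O(k))\<close>, a small power of
  \<open>n\<close> since \<open>C * k \<le> ln n\<close>.\<close>

lemma embedding_parameters:
  fixes \<epsilon> D M \<gamma> :: real
  assumes "0 < \<epsilon>" "1 \<le> D" "0 < M" "0 < \<gamma>" "1 < (1 + \<epsilon>) * (\<gamma> * M)"
  obtains C\<^sub>0 :: real where "\<And>(C::real) (n::nat) (\<Delta>::nat) (k::int) (m::real).
    \<lbrakk>C\<^sub>0 \<le> C; C * n / ln n \<le> \<Delta>; k = \<lceil>(real n - 1) / \<Delta>\<rceil> - 1; 2 \<le> k; 2 \<le> n; \<gamma> * n \<le> m; m \<le> n\<rbrakk> \<Longrightarrow>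
    \<exists>q d. d = real n powr (1 - (1 + \<epsilon>) / of_int k) \<and> 0 < q \<and> q < 1 \<and> d < m \<and> d \<le> q * (m - d) \<and>
      n * exp (D * m / (\<Delta> / M)) < (1 / q) powr ((m - D * d) / (\<Delta> / M))"
proof -
  \<comment> \<open>Lowering \<open>\<gamma>\<close> to \<open>\<gamma>'\<close> leaves room for the
    loss \<open>D * d\<close> and keeps \<open>(1 + \<epsilon>) * \<gamma>' * M\<close> above
    1.\<close>
  obtain \<gamma>' where \<gamma>': "\<gamma>' < \<gamma>" "1 / ((1 + \<epsilon>) * M) < \<gamma>'"
  proof -
    have "1 / ((1 + \<epsilon>) * M) < \<gamma>" using assms by (simp add: pos_divide_less_eq mult_ac)
    then show thesis using dense that by blast
  qed
  have \<gamma>'0: "0 < \<gamma>'" using \<gamma>'(2) assms by (smt (verit) divide_pos_pos mult_pos_pos)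
  define \<beta> where "\<beta> = \<gamma>' * M"
  have \<beta>: "0 < \<beta>" "0 < \<beta> * (1 + \<epsilon>) - 1" unfolding \<beta>_def using \<gamma>'0 \<gamma>'(2) assms by (simp_all add: pos_divide_less_eq mult_ac)
  \<comment> \<open>The summands ensure, in order, \<open>1 < C\<close>,
    \<open>D * \<delta> \<le> \<gamma> - \<gamma>'\<close>, \<open>q < 1\<close>, and that
    \<open>ln n\<close> outweighs the terms linear in \<open>k\<close>.\<close>
  define C\<^sub>0 where "C\<^sub>0 = 1 + D / (\<gamma> - \<gamma>') + 1 / \<gamma>' + (2 * D * M + \<beta> * \<bar>ln \<gamma>'\<bar>) / (\<beta> * (1 + \<epsilon>) - 1)"
  have terms: "0 < D / (\<gamma> - \<gamma>')" "0 < 1 / \<gamma>'" "0 \<le> (2 * D * M + \<beta> * \<bar>ln \<gamma>'\<bar>) / (\<beta> * (1 + \<epsilon>) - 1)"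
    using assms \<gamma>' \<gamma>'0 \<beta> by auto
  show thesis
  proof (rule that[of C\<^sub>0])
    fix C :: real and n \<Delta> :: nat and k :: int and m :: real
    assume C: "C\<^sub>0 \<le> C" and \<Delta>: "C * n / ln n \<le> \<Delta>" and k: "k = \<lceil>(real n - 1) / \<Delta>\<rceil> - 1" "2 \<le> k"
      and n: "2 \<le> n" and m: "\<gamma> * n \<le> m" "m \<le> n"
    have L: "0 < ln (real n)" using n by simp
    have C0: "1 < C" using C terms unfolding C\<^sub>0_def by linarith
    have "0 < C * n / ln n" using C0 n L by simp
    then have \<Delta>0: "0 < real \<Delta>" using \<Delta> by linarith
    have k_less: "of_int k < (real n - 1) / \<Delta>" and n_le: "(real n - 1) / \<Delta> \<le> of_int k + 1"
      using k(1) by linarith+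
    have k2: "2 \<le> real_of_int k" using k(2) by simp
    have kn: "of_int k \<le> n / \<Delta>"
      using k_less divide_right_mono[of "real n - 1" "real n" "real \<Delta>"] by simp
    \<comment> \<open>\<open>n / \<Delta>\<close> is at most
      \<open>k + 1 + 1 / \<Delta> \<le> k + 2\<close>, and \<open>2 \<le> k\<close> absorbs the
      additive part.\<close>
    have "1 / real \<Delta> \<le> 1" using \<Delta>0 by simp
    then have nk: "n / \<Delta> \<le> 2 * of_int k" using n_le k2 by (simp add: diff_divide_distrib)
    have Ck: "C * of_int k \<le> ln n"
    proof -
      have "C * n \<le> \<Delta> * ln n" using \<Delta> L by (simp add: field_simps)
      moreover have "of_int k * real \<Delta> \<le> real n" using kn \<Delta>0 by (simp add: field_simps)
      then have "C * (of_int k * \<Delta>) \<le> C * n" using C0 by (intro mult_left_mono) auto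
      ultimately have "\<Delta> * (C * of_int k) \<le> \<Delta> * ln n" by (simp add: mult_ac)
      then show ?thesis using \<Delta>0 by simp
    qed
    define \<delta> where "\<delta> = exp (- ((1 + \<epsilon>) * ln n / of_int k))"
    have d: "real n powr (1 - (1 + \<epsilon>) / of_int k) = \<delta> * n"
    proof -
      have "real n powr (1 - (1 + \<epsilon>) / of_int k) = n / n powr ((1 + \<epsilon>) / of_int k)"
        using n by (subst powr_diff) simp
      also have "\<dots> = \<delta> * n"
        using n unfolding \<delta>_def by (simp add: powr_def exp_minus divide_inverse mult_ac)
      finally show ?thesis .
    qed
    have "C \<le> ln n / of_int k" using Ck k2 by (simp add: field_simps)
    also have "\<dots> \<le> (1 + \<epsilon>) * ln n / of_int k"
      using L k2 assms(1) by (intro divide_right_mono) auto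
    finally have "\<delta> \<le> exp (- C)" unfolding \<delta>_def by simp
    also have "\<dots> \<le> 1 / C"
      using exp_ge_add_one_self[of C] C0 by (simp add: exp_minus field_simps)
    finally have \<delta>C: "\<delta> * C \<le> 1" using C0 by (simp add: field_simps)
    have \<delta>0: "0 < \<delta>" unfolding \<delta>_def by simp
    have "\<delta> * (D / (\<gamma> - \<gamma>')) \<le> \<delta> * C"
      using C terms \<delta>0 unfolding C\<^sub>0_def by (intro mult_left_mono) linarith+
    then have "\<delta> * (D / (\<gamma> - \<gamma>')) \<le> 1" using \<delta>C by linarith
    then have \<delta>1: "D * \<delta> \<le> \<gamma> - \<gamma>'" using \<gamma>'(1) by (simp add: field_simps)
    have "\<delta> * (1 / \<gamma>') < \<delta> * C"
      using C terms \<delta>0 unfolding C\<^sub>0_def by (intro mult_strict_left_mono) linarith+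
    then have \<delta>2: "\<delta> / \<gamma>' < 1" using \<delta>C by simp
    \<comment> \<open>With this \<open>q\<close>, \<open>d = \<delta> * n\<close> equals
      \<open>q * (\<gamma>' * n)\<close>, and \<open>\<gamma>' * n\<close> is at most
      \<open>m - d\<close>.\<close>
    define q where "q = \<delta> / \<gamma>'"
    have q: "0 < q" "q < 1" unfolding q_def using \<delta>0 \<gamma>'0 \<delta>2 by auto
    have "D * \<delta> * n \<le> (\<gamma> - \<gamma>') * n" using \<delta>1 by (intro mult_right_mono) auto
    then have mD: "\<gamma>' * n \<le> m - D * (\<delta> * n)" using m by (simp add: algebra_simps)
    have "1 * (\<delta> * n) \<le> D * (\<delta> * n)" using assms(2) \<delta>0 by (intro mult_right_mono) auto
    then have md: "\<gamma>' * n \<le> m - \<delta> * n" using mD by linarith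
    have dm: "\<delta> * n < m" using md \<gamma>'0 n by (smt (verit) mult_pos_pos of_nat_0_less_iff zero_less_numeral order_less_le_trans)
    have "\<delta> * n = q * (\<gamma>' * n)" unfolding q_def using \<gamma>'0 by simp
    also have "\<dots> \<le> q * (m - \<delta> * n)" using md q by (intro mult_left_mono) auto
    finally have dq: "\<delta> * n \<le> q * (m - \<delta> * n)" .
    have "\<beta> * of_int k \<le> \<beta> * (n / \<Delta>)" using kn \<beta> by (intro mult_left_mono) auto
    also have "\<dots> = (\<gamma>' * n) / (\<Delta> / M)" unfolding \<beta>_def by simp
    also have "\<dots> \<le> (m - D * (\<delta> * n)) / (\<Delta> / M)" using mD \<Delta>0 assms(3) by (intro divide_right_mono) auto
    finally have expo: "\<beta> * of_int k \<le> (m - D * (\<delta> * n)) / (\<Delta> / M)" .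
    have "D * m / (\<Delta> / M) = D * M * (m / \<Delta>)" by simp
    also have "\<dots> \<le> D * M * (2 * of_int k)"
      using nk m \<Delta>0 assms by (intro mult_left_mono) (auto intro: order_trans[OF divide_right_mono])
    finally have left: "D * m / (\<Delta> / M) \<le> 2 * D * M * of_int k" by simp
    have "ln (1 / q) = ln \<gamma>' + (1 + \<epsilon>) * ln n / of_int k"
      unfolding q_def \<delta>_def using \<gamma>'0 by (simp add: ln_div)
    then have "\<beta> * of_int k * ln (1 / q) = \<beta> * of_int k * ln \<gamma>' + \<beta> * (1 + \<epsilon>) * ln n"
      using k2 by (simp add: field_simps)
    moreover have "- (\<beta> * of_int k * \<bar>ln \<gamma>'\<bar>) \<le> \<beta> * of_int k * ln \<gamma>'"
    proof -
      have "\<beta> * of_int k * (- \<bar>ln \<gamma>'\<bar>) \<le> \<beta> * of_int k * ln \<gamma>'" using \<beta> k2 by (intro mult_left_mono) auto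
      then show ?thesis by simp
    qed
    moreover have "of_int k * (2 * D * M + \<beta> * \<bar>ln \<gamma>'\<bar>) < (\<beta> * (1 + \<epsilon>) - 1) * ln n"
    proof -
      have "(2 * D * M + \<beta> * \<bar>ln \<gamma>'\<bar>) / (\<beta> * (1 + \<epsilon>) - 1) < C"
        using C terms unfolding C\<^sub>0_def by linarith
      then have "2 * D * M + \<beta> * \<bar>ln \<gamma>'\<bar> < (\<beta> * (1 + \<epsilon>) - 1) * C" using \<beta> by (simp add: field_simps)
      then have "of_int k * (2 * D * M + \<beta> * \<bar>ln \<gamma>'\<bar>) < of_int k * ((\<beta> * (1 + \<epsilon>) - 1) * C)"
        using k2 by (intro mult_strict_left_mono) auto
      also have "\<dots> = (\<beta> * (1 + \<epsilon>) - 1) * (C * of_int k)" by simp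
      also have "\<dots> \<le> (\<beta> * (1 + \<epsilon>) - 1) * ln n" using Ck \<beta> by (intro mult_left_mono) auto
      finally show ?thesis .
    qed
    ultimately have "ln n + 2 * D * M * of_int k < \<beta> * of_int k * ln (1 / q)"
      by (simp add: algebra_simps)
    then have "exp (ln n + 2 * D * M * of_int k) < (1 / q) powr (\<beta> * of_int k)"
      unfolding powr_def using q by simp
    moreover have "n * exp (D * m / (\<Delta> / M)) \<le> exp (ln n + 2 * D * M * of_int k)"
      using left n by (simp add: exp_add)
    moreover have "(1 / q) powr (\<beta> * of_int k) \<le> (1 / q) powr ((m - D * (\<delta> * n)) / (\<Delta> / M))"
      using expo q by (intro powr_mono) auto
    ultimately have "n * exp (D * m / (\<Delta> / M)) < (1 / q) powr ((m - D * (\<delta> * n)) / (\<Delta> / M))" by linarith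
    then show "\<exists>q d. d = real n powr (1 - (1 + \<epsilon>) / of_int k) \<and> 0 < q \<and> q < 1 \<and> d < m \<and> d \<le> q * (m - d) \<and>
      n * exp (D * m / (\<Delta> / M)) < (1 / q) powr ((m - D * d) / (\<Delta> / M))"
      by (intro exI[of _ q] exI[of _ "\<delta> * n"] conjI d[symmetric] q dm dq)
  qed
qed

section \<open>Passing between trees, relations and pair graphs\<close>

lemma pcas_vwalk_arcs: "pcas u (vwalk_arcs (u # zs)) (last (u # zs))"
  by (induction zs arbitrary: u) auto

lemma pawalk_verts_vwalk_arcs: "pawalk_verts u (vwalk_arcs (u # zs)) = u # zs"
  by (induction zs arbitrary: u) auto

text \<open>If every vertex of some set had two neighbours inside it, a longest path in the set
  would close up to a cycle.\<close>

lemma undirected_tree_one_degenerate: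
  assumes "undirected_tree T"
  shows "one_degenerate (\<lambda>u v. (u, v) \<in> parcs T) (pverts T)"
proof (rule ccontr)
  interpret pair_graph T using assms unfolding undirected_tree_def by blast
  assume "\<not> ?thesis"
  then obtain S where S: "S \<subseteq> pverts T" "S \<noteq> {}" "\<And>v. v \<in> S \<Longrightarrow> 1 < card {u\<in>S. (v, u) \<in> parcs T}"
    unfolding one_degenerate_def by (auto simp: not_le)
  have fS: "finite S" using S(1) pair_finite_verts finite_subset by blast
  \<comment> \<open>Every neighbour of the first vertex of a longest path lies on the path.\<close>
  define P where "P xs \<longleftrightarrow> xs \<noteq> [] \<and> distinct xs \<and> set xs \<subseteq> S \<and> set (vwalk_arcs xs) \<subseteq> parcs T" for xs
  obtain s where "s \<in> S" using S(2) by blast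
  then have "P [s]" unfolding P_def by simp
  moreover have "length xs \<le> card S" if "P xs" for xs
    using that card_mono[OF fS, of "set xs"] distinct_card[of xs] unfolding P_def by simp
  ultimately obtain xs where xs: "P xs" and max: "\<And>ys. P ys \<Longrightarrow> length ys \<le> length xs"
    using ex_has_greatest_nat[of P "[s]" length "Suc (card S)"] by (auto simp: less_Suc_eq_le)
  obtain x ys where xys: "xs = x # ys" using xs unfolding P_def by (cases xs) auto
  let ?A = "{u\<in>S. (x, u) \<in> parcs T}"
  have "x \<in> S" using xs unfolding xys P_def by simp
  then have A: "1 < card ?A" by (rule S(3))
  have A_ys: "u \<in> set ys" if u: "u \<in> ?A" for u
  proof (rule ccontr)
    assume "u \<notin> set ys"
    moreover have "u \<noteq> x" using u no_loops' by auto
    moreover have "(u, x) \<in> parcs T" using u arcs_symmetric by blast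
    ultimately have "P (u # xs)" using xs u unfolding P_def xys by simp
    then show False using max by force
  qed
  \<comment> \<open>A neighbour of \<open>x\<close> other than the second path vertex is needed:
    closing up at \<open>hd ys\<close> would only walk along an edge and back.\<close>
  have "\<not> ?A \<subseteq> {hd ys}" using A card_mono[of "{hd ys}" ?A] by auto
  then obtain y where y: "y \<in> ?A" "y \<noteq> hd ys" by blast
  obtain as bs where ys: "ys = as @ y # bs" using A_ys[OF y(1)] by (meson split_list)
  have as: "as \<noteq> []" using y(2) ys by auto
  define p where "p = (y, x) # vwalk_arcs (x # as @ [y])"
  have "xs = (x # as @ [y]) @ bs" unfolding xys ys by simp
  then have "set (vwalk_arcs (x # as @ [y])) \<subseteq> parcs T" "distinct (x # as @ [y])"
    using xs set_vwalk_arcs_append1[of "x # as @ [y]" bs] unfolding P_def by auto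
  moreover have "(y, x) \<in> parcs T" using y(1) arcs_symmetric by blast
  moreover have "pcas y p y" unfolding p_def using pcas_vwalk_arcs[of x "as @ [y]"] by simp
  moreover have "tl (pawalk_verts y p) = x # as @ [y]"
    unfolding p_def using pawalk_verts_vwalk_arcs[of x "as @ [y]"] by simp
  moreover have "y \<in> pverts T" using y(1) S(1) by auto
  ultimately have "cycle p" unfolding cycle_def awalk_def by (auto simp: p_def)
  moreover have "3 \<le> length p"
    using vwalk_length_simp[of "x # as @ [y]"] as unfolding p_def vwalk_length_def by (cases as) auto
  ultimately show False using assms unfolding undirected_tree_def undirected_cycle_def by blast
qed

lemma contains_copyI:
  assumes G: "pair_graph G" and T: "pair_graph T"
    and f: "inj_on f (pverts T)" "f ` pverts T \<subseteq> pverts G"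
      "\<And>u v. (u, v) \<in> parcs T \<Longrightarrow> (f u, f v) \<in> parcs G"
  shows "contains_copy G T"
proof -
  interpret G: pair_graph G by (fact G)
  interpret T: pair_graph T by (fact T)
  define H where "H = \<lparr>pverts = f ` pverts T, parcs = map_prod f f ` parcs T\<rparr>"
  have H: "pair_wf_digraph H"
    using T.wellformed' by unfold_locales (auto simp: H_def)
  have sub: "parcs T \<subseteq> pverts T \<times> pverts T" using T.wellformed' by auto
  have "subgraph (with_proj H) (with_proj G)"
    using f H G.wf_digraph_axioms by (intro subgraphI) (auto simp: H_def wf_digraph_wp_iff)
  moreover have "digraph_iso (with_proj T) (with_proj H)"
    unfolding digraph_iso_def
  proof (intro exI conjI)
    let ?h = "\<lparr>iso_verts = f, iso_arcs = map_prod f f, iso_head = snd, iso_tail = fst\<rparr>"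
    have "inj_on (map_prod f f) (parcs T)"
      using inj_on_subset[OF map_prod_inj_on[OF f(1) f(1)] sub] .
    then show "pre_digraph.digraph_isomorphism (with_proj T) ?h"
      unfolding pre_digraph.digraph_isomorphism_def using f T.wf_digraph_axioms by auto
    show "with_proj H = app_iso ?h (with_proj T)"
      by (simp add: with_proj_def app_iso_def H_def)
  qed
  ultimately show ?thesis unfolding contains_copy_def by blast
qed

lemma (in pair_graph) out_degree_eq_card: "out_degree (with_proj G) v = card {u\<in>pverts G. (v, u) \<in> parcs G}"
proof -
  have "out_arcs (with_proj G) v = Pair v ` {u\<in>pverts G. (v, u) \<in> parcs G}"
    using wellformed' by (auto simp: out_arcs_def)
  then show ?thesis unfolding out_degree_def by (simp add: card_image inj_on_def)
qed

text \<open>The vertex \<open>v\<close> counts as its own non-neighbour, so the bound is the order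
  minus the minimum degree, without a further 1.\<close>

lemma (in pair_graph) card_nonneighbours_le:
  assumes "v \<in> pverts G"
  shows "real (card {u\<in>pverts G. (v, u) \<notin> parcs G}) \<le> real (card (pverts G)) - real (min_degree G)"
proof -
  have "min_degree G \<le> card {u\<in>pverts G. (v, u) \<in> parcs G}"
    unfolding min_degree_def using assms pair_finite_verts
    by (intro Min_le) (auto simp flip: out_degree_eq_card)
  moreover have "card (pverts G) = card {u\<in>pverts G. (v, u) \<in> parcs G} + card {u\<in>pverts G. (v, u) \<notin> parcs G}"
    using pair_finite_verts by (subst card_Un_disjoint[symmetric]) (auto intro: arg_cong[where f=card])
  ultimately show ?thesis by linarith
qed

lemma (in pair_graph) card_neighbours_le_max_degree:
  assumes "v \<in> pverts G"
  shows "card {u\<in>pverts G. (v, u) \<in> parcs G} \<le> max_degree G"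
  unfolding max_degree_def using assms pair_finite_verts
  by (intro Max_ge) (auto simp flip: out_degree_eq_card)

section \<open>Constants and the two cases\<close>

theorem theorem1p1:
  shows "\<forall>\<epsilon>::real. \<epsilon> > 0 \<longrightarrow>
    (\<exists>C::real. C > 1 \<and>
      (\<exists>n\<^sub>0::nat. \<forall>n\<ge>n\<^sub>0. \<forall>(\<Delta>::nat) (k::int).
        real \<Delta> \<ge> C * real n / ln (real n) \<longrightarrow>
        k = \<lceil>(real n - 1) / real \<Delta>\<rceil> - 1 \<longrightarrow>
        k \<ge> 2 \<longrightarrow>
        (\<forall>G :: 'a pair_pre_digraph.
          pair_graph G \<longrightarrow>
          card (pverts G) = n \<longrightarrow>
          real (min_degree G) \<ge> real n - real n powr (1 - (1 + \<epsilon>) / real_of_int k) \<longrightarrow>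
          (\<forall>T \<in> (bounded_degree_trees n \<Delta> :: 'b pair_pre_digraph set). contains_copy G T))))"
proof (intro allI impI)
  fix \<epsilon> :: real assume \<epsilon>: "\<epsilon> > 0"
  \<comment> \<open>Then \<open>(1 + \<epsilon>) * (1 - 4 * \<eta>) = 1 + \<epsilon> / 2\<close>,
    which exceeds 1 as the leaf case requires.\<close>
  define \<eta> where "\<eta> = \<epsilon> / (8 * (1 + \<epsilon>))"
  have \<eta>: "0 < \<eta>" "\<eta> < 1/8" unfolding \<eta>_def using \<epsilon> by (auto simp: field_simps)
  \<comment> \<open>In the bounded-degree case \<open>M = 8 / \<eta>\<close> makes
    \<open>\<gamma> * M = 2\<close>.\<close>
  have "1 < (1 + \<epsilon>) * (\<eta> / 4 * (8 / \<eta>))" using \<epsilon> \<eta> by simp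
  then obtain C1 where C1: "\<And>(C::real) (n::nat) (\<Delta>::nat) (k::int) (m::real).
    \<lbrakk>C1 \<le> C; C * n / ln n \<le> \<Delta>; k = \<lceil>(real n - 1) / \<Delta>\<rceil> - 1; 2 \<le> k; 2 \<le> n; \<eta> / 4 * n \<le> m; m \<le> n\<rbrakk> \<Longrightarrow>
    \<exists>q d. d = real n powr (1 - (1 + \<epsilon>) / of_int k) \<and> 0 < q \<and> q < 1 \<and> d < m \<and> d \<le> q * (m - d) \<and>
      n * exp (4 / \<eta> * m / (\<Delta> / (8 / \<eta>))) < (1 / q) powr ((m - 4 / \<eta> * d) / (\<Delta> / (8 / \<eta>)))"
    using embedding_parameters[of \<epsilon> "4 / \<eta>" "8 / \<eta>" "\<eta> / 4"] \<epsilon> \<eta> by (auto simp: field_simps)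
  have "1 < (1 + \<epsilon>) * ((1 - 4 * \<eta>) * 1)" unfolding \<eta>_def using \<epsilon> by (simp add: field_simps add_pos_pos)
  then obtain C2 where C2: "\<And>(C::real) (n::nat) (\<Delta>::nat) (k::int) (m::real).
    \<lbrakk>C2 \<le> C; C * n / ln n \<le> \<Delta>; k = \<lceil>(real n - 1) / \<Delta>\<rceil> - 1; 2 \<le> k; 2 \<le> n; (1 - 4 * \<eta>) * n \<le> m; m \<le> n\<rbrakk> \<Longrightarrow>
    \<exists>q d. d = real n powr (1 - (1 + \<epsilon>) / of_int k) \<and> 0 < q \<and> q < 1 \<and> d < m \<and> d \<le> q * (m - d) \<and>
      n * exp (1 * m / (\<Delta> / 1)) < (1 / q) powr ((m - 1 * d) / (\<Delta> / 1))"
    using embedding_parameters[of \<epsilon> 1 1 "1 - 4 * \<eta>"] \<epsilon> \<eta> by auto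
  define C where "C = max 2 (max C1 C2)"
  have C: "C > 1" "C1 \<le> C" "C2 \<le> C" unfolding C_def by auto
  have "((\<lambda>n. ln (real n) / real n) \<longlongrightarrow> 0) sequentially"
    using filterlim_compose[OF ln_x_over_x_tendsto_0 filterlim_real_sequentially] .
  \<comment> \<open>The value 48 yields \<open>\<Delta> \<ge> 48 / \<eta>\<^sup>2\<close>, which is
    \<open>6 \<le> \<eta> * s\<close> for \<open>s = \<Delta> / (8 / \<eta>)\<close>.\<close>
  then have "\<forall>\<^sub>F n in sequentially. ln (real n) / real n < \<eta>\<^sup>2 / 48"
    using \<eta> by (intro order_tendstoD) auto
  then obtain n1 where n1: "\<And>n. n \<ge> n1 \<Longrightarrow> ln (real n) / real n < \<eta>\<^sup>2 / 48"
    unfolding eventually_sequentially by blast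
  show "\<exists>C::real. C > 1 \<and>
      (\<exists>n\<^sub>0::nat. \<forall>n\<ge>n\<^sub>0. \<forall>(\<Delta>::nat) (k::int).
        real \<Delta> \<ge> C * real n / ln (real n) \<longrightarrow>
        k = \<lceil>(real n - 1) / real \<Delta>\<rceil> - 1 \<longrightarrow>
        k \<ge> 2 \<longrightarrow>
        (\<forall>G :: 'a pair_pre_digraph.
          pair_graph G \<longrightarrow>
          card (pverts G) = n \<longrightarrow>
          real (min_degree G) \<ge> real n - real n powr (1 - (1 + \<epsilon>) / real_of_int k) \<longrightarrow>
          (\<forall>T \<in> (bounded_degree_trees n \<Delta> :: 'b pair_pre_digraph set). contains_copy G T)))"
  proof (intro exI[of _ C] conjI C(1) exI[of _ "max 2 n1"] allI impI ballI)
    fix n \<Delta> :: nat and k :: int and G :: "'a pair_pre_digraph" and T :: "'b pair_pre_digraph"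
    assume n: "max 2 n1 \<le> n" and \<Delta>: "real \<Delta> \<ge> C * real n / ln (real n)"
      and k: "k = \<lceil>(real n - 1) / real \<Delta>\<rceil> - 1" "k \<ge> 2"
      and G: "pair_graph G" "card (pverts G) = n"
      and min: "real (min_degree G) \<ge> real n - real n powr (1 - (1 + \<epsilon>) / real_of_int k)"
      and "T \<in> bounded_degree_trees n \<Delta>"
    then have tree: "undirected_tree T" and cT: "card (pverts T) = n" and max: "max_degree T \<le> \<Delta>"
      unfolding bounded_degree_trees_def by auto
    interpret G: pair_graph G by (fact G)
    interpret T: pair_graph T using tree unfolding undirected_tree_def by blast
    have n2: "2 \<le> n" using n by simp
    define E where "E u v \<longleftrightarrow> (u, v) \<in> parcs T" for u v
    define N where "N u v \<longleftrightarrow> (u, v) \<in> parcs G" for u v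
    define d where "d = real n powr (1 - (1 + \<epsilon>) / real_of_int k)"
    have d0: "0 \<le> d" unfolding d_def by simp
    have E: "symp E" "irreflp E" "one_degenerate E (pverts T)"
      using T.arcs_symmetric T.no_loops' undirected_tree_one_degenerate[OF tree]
      unfolding E_def symp_def irreflp_def by blast+
    have N: "symp N" using G.arcs_symmetric unfolding N_def symp_def by blast
    have nonnbrs: "real (card {y\<in>pverts G. \<not> N x y}) \<le> d" if "x \<in> pverts G" for x
      using G.card_nonneighbours_le[OF that] min G(2) unfolding N_def d_def by linarith
    have deg: "card {u\<in>pverts T. E v u} \<le> \<Delta>" if "v \<in> pverts T" for v
      using T.card_neighbours_le_max_degree[OF that] max unfolding E_def by linarith
    have embed: "contains_copy G T"
      if I: "I \<subseteq> pverts T" "\<forall>u\<in>I. \<forall>v\<in>I. \<not> E u v" and D: "\<And>i. i \<in> I \<Longrightarrow> card {p\<in>pverts T. E i p} \<le> D"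
        and W: "0 < W" "\<And>p. p \<in> pverts T \<Longrightarrow> card {i\<in>I. E p i} \<le> W"
        and q: "d < card I" "0 < q" "q < 1" "d \<le> q * (card I - d)"
          "n * exp (D * card I / W) < (1 / q) powr ((card I - D * d) / W)"
      for I and D W q :: real
    proof -
      obtain f where "bij_betw f (pverts T) (pverts G)" "\<forall>u\<in>pverts T. \<forall>v\<in>pverts T. E u v \<longrightarrow> N (f u) (f v)"
        using spanning_embedding[OF G.pair_finite_verts N nonnbrs T.pair_finite_verts E(3) _ E(1,2) I D W d0 q(1-4)]
          q(5) G(2) cT by auto
      then show ?thesis
        using T.wellformed' by (intro contains_copyI[OF G(1) T.pair_graph_axioms, of f])
          (auto simp: bij_betw_def E_def N_def)
    qed
    have ln0: "0 < ln (real n)" using n2 by simp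
    have "real n / ln (real n) \<le> C * real n / ln (real n)" using C(1) ln0 mult_right_mono[of 1 C "real n"] by (intro divide_right_mono) auto
    then have \<Delta>n: "real n / ln (real n) \<le> \<Delta>" using \<Delta> by linarith
    have "48 / \<eta>\<^sup>2 < real n / ln (real n)"
      using n1[of n] n ln0 \<eta> by (simp add: field_simps)
    then have large: "48 / \<eta>\<^sup>2 \<le> \<Delta>" using \<Delta>n by linarith
    have "0 < 48 / \<eta>\<^sup>2" using \<eta> by simp
    then have \<Delta>0: "0 < real \<Delta>" using large by linarith
    have cI: "real (card I) \<le> n" if "I \<subseteq> pverts T" for I
      using card_mono[OF T.pair_finite_verts that] cT by simp
    have s: "6 \<le> \<eta> * (\<Delta> / (8 / \<eta>))" using large \<eta> by (simp add: field_simps power2_eq_square)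
    show "contains_copy G T"
    proof (cases rule: independent_set_dichotomy[OF T.pair_finite_verts E(3,1,2) \<eta>(1) s])
      case (1 I)
      then obtain q where "0 < q" "q < 1" "d < card I" "d \<le> q * (card I - d)"
        "n * exp (4 / \<eta> * card I / (\<Delta> / (8 / \<eta>))) < (1 / q) powr ((card I - 4 / \<eta> * d) / (\<Delta> / (8 / \<eta>)))"
        using C1[OF C(2) \<Delta> k n2 _ cI] unfolding cT d_def by blast
      with 1 \<Delta>0 \<eta> show ?thesis by (intro embed[of I "4 / \<eta>" "\<Delta> / (8 / \<eta>)" q]) auto
    next
      case (2 I)
      then obtain q where q: "0 < q" "q < 1" "d < card I" "d \<le> q * (card I - d)"
        "n * exp (1 * real (card I) / (\<Delta> / 1)) < (1 / q) powr ((card I - 1 * d) / (\<Delta> / 1))"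
        using C2[OF C(3) \<Delta> k n2 _ cI] unfolding cT d_def by blast
      \<comment> \<open>For leaves the maximum degree itself serves as \<open>W\<close>.\<close>
      have "card {i\<in>I. E p i} \<le> \<Delta>" if p: "p \<in> pverts T" for p
      proof -
        have "card {i\<in>I. E p i} \<le> card {u\<in>pverts T. E p u}"
          using 2(1) T.pair_finite_verts by (intro card_mono) auto
        then show ?thesis using deg[OF p] by linarith
      qed
      with 2 \<Delta>0 q show ?thesis by (intro embed[of I 1 "\<Delta> / 1" q]) auto
    qed
  qed
qed

end
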